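(* Let $\mathcal{O}$ be an annotated $\mathcal{ELH}^r$ ontology, $\alpha$ an axiom and $m$ a monomial. Let $\mathcal{O}'$ be obtained from $\mathcal{O}$ by exhaustively applying the normalisation rules $\mathsf{NF}_1$–$\mathsf{NF}_3$ below. Then: (1) if $\mathcal{O}\models(\alpha,m)$, then $\mathcal{O}'\models(\alpha,m)$; (2) if $\mathcal{O}'\models(\alpha,m)$ and every concept name occurring in $\alpha$ occurs in $\mathcal{O}$, then $\mathcal{O}\models(\alpha,m)$. Normalisation rules, where $\widehat{C},\widehat{D}$ denote concepts not in $N_C\cup\{\top\}$, $C,E$ are concepts, $R\in N_R$, $v$ is the annotation, and $A$ is a fresh concept name (not occurring in the current ontology) each time a rule is applied: $\mathsf{NF}_1$: replace $(C\sqcap\widehat{D}\sqsubseteq E,v)$ by $(\widehat{D}\sqsubseteq A,1)$ and $(C\sqcap A\sqsubseteq E,v)$; $\mathsf{NF}_2$: replace $(\exists R.\widehat{C}\sqsubseteq D,v)$ by $(\widehat{C}\sqsubseteq A,1)$ and $(\exists R.A\sqsubseteq D,v)$; $\mathsf{NF}_3$: replace $(\widehat{C}\sqsubseteq \exists R,v)$ by $(\widehat{C}\sqsubseteq A,1)$ and $(A\sqsubseteq\exists R,v)$.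
   Context: Fix pairwise disjoint countably infinite sets $N_C$ (concept names), $N_R$ (role names), $N_I$ (individual names), $N_V$ (provenance variables). A monomial is a finite product of variables from $N_V$ (the empty product is $1$); $N_M$ is the set of monomials. Products are computed in the Trio semiring: $\times$ is commutative, associative and idempotent ($v\times v=v$), so monomials $m,n$ are equivalent, $m\approx n$, iff they contain the same set of variables; the representative $[m]$ is the product of the distinct variables of $m$ in lexicographic order. $\mathcal{ELH}^r$ concepts: $C::=A\mid\exists R.C\mid C\sqcap C\mid\top$ ($A\in N_C$, $R\in N_R$). Axioms are GCIs $C\sqsubseteq D$ with $C$ a concept and $D::=A\mid\exists R$; role inclusions $R\sqsubseteq S$; range restrictions ${\sf ran}(R)\sqsubseteq A$; assertions $A(a)$, $R(a,b)$ ($a,b\in N_I$). An annotated axiom is a pair $(\alpha,m)$, $m\in N_M$. An annotated $\mathcal{ELH}^r$ ontology is a finite set of annotated axioms $(\alpha,v)$ with $v\in N_V\cup\{1\}$. An annotated interpretation $\mathcal{I}=(\Delta^\mathcal{I},\Delta^\mathcal{I}_{m},\cdot^\mathcal{I})$ consists of non-empty disjoint sets $\Delta^\mathcal{I},\Delta^\mathcal{I}_m$ and a map with $a^\mathcal{I}\in\Delta^\mathcal{I}$, $A^\mathcal{I}\subseteq\Delta^\mathcal{I}\times\Delta^\mathcal{I}_m$, $R^\mathcal{I}\subseteq\Delta^\mathcal{I}\times\Delta^\mathcal{I}\times\Delta^\mathcal{I}_m$, and $m^\mathcal{I}\in\Delta^\mathcal{I}_m$ for each monomial with $m^\mathcal{I}=n^\mathcal{I}$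 iff $m\approx n$. It is extended by: $\top^\mathcal{I}=\Delta^\mathcal{I}\times\{1^\mathcal{I}\}$; $(\exists R)^\mathcal{I}=\{(d,\mu)\mid\exists e\,(d,e,\mu)\in R^\mathcal{I}\}$; $({\sf ran}(R))^\mathcal{I}=\{(e,\mu)\mid\exists d\,(d,e,\mu)\in R^\mathcal{I}\}$; $(C\sqcap D)^\mathcal{I}=\{(d,(m\times n)^\mathcal{I})\mid(d,m^\mathcal{I})\in C^\mathcal{I},(d,n^\mathcal{I})\in D^\mathcal{I}\}$; $(\exists R.C)^\mathcal{I}=\{(d,(m\times n)^\mathcal{I})\mid\exists e\,(d,e,m^\mathcal{I})\in R^\mathcal{I},(e,n^\mathcal{I})\in C^\mathcal{I}\}$. $\mathcal{I}$ satisfies $(R\sqsubseteq S,m)$ if for all $n\in N_M$, $(d,e,n^\mathcal{I})\in R^\mathcal{I}$ implies $(d,e,(m\times n)^\mathcal{I})\in S^\mathcal{I}$; $(G\sqsubseteq D,m)$ ($G$ a concept or ${\sf ran}(R)$, $D$ a concept) if for all $n$, $(d,n^\mathcal{I})\in G^\mathcal{I}$ implies $(d,(m\times n)^\mathcal{I})\in D^\mathcal{I}$; $(A(a),m)$ if $(a^\mathcal{I},m^\mathcal{I})\in A^\mathcal{I}$; $(R(a,b),m)$ if $(a^\mathcal{I},b^\mathcal{I},m^\mathcal{I})\in R^\mathcal{I}$. $\mathcal{I}$ is a model of $\mathcal{O}$ if it satisfies all its annotated axioms; $\mathcal{O}\models(\alpha,m)$ if every model of $\mathcal{O}$ satisfies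 $(\alpha,m)$. *)

theory Defs
  imports Main "HOL-Library.Multiset" "HOL-Library.Countable" "HOL-Library.Infinite_Typeclass"
begin

text \<open>
  Concept, role and individual names and provenance variables are the elements of four type
  variables; distinct types make the name sets disjoint.

  Monomials are multisets of variables: \<open>+\<close> is the product and \<open>{#}\<close> the empty product 1.
  Idempotency of the Trio semiring is not built into the type but enters through
  \<open>mon_equiv\<close>.
\<close>

type_synonym 'v monomial = "'v multiset"

definition mon_equiv :: "'v monomial \<Rightarrow> 'v monomial \<Rightarrow> bool" (infix "\<approx>" 50) where
  "m \<approx> n \<longleftrightarrow> set_mset m = set_mset n"

datatype (concept_cnames: 'c, concept_rnames: 'r) concept =
    Top
  | Atom 'c
  | Exists 'r "('c, 'r) concept"
  | Conj "('c, 'r) concept" "('c, 'r) concept"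

text \<open>Right-hand sides of GCIs: a concept name or an unqualified existential.\<close>

datatype (rhs_cnames: 'c, rhs_rnames: 'r) rhs =
    RAtom 'c
  | RSome 'r

datatype (axiom_cnames: 'c, axiom_rnames: 'r, axiom_inames: 'i) elhr_axiom =
    GCI "('c, 'r) concept" "('c, 'r) rhs"
  | RoleIncl 'r 'r
  | RangeRestr 'r 'c
  | ConceptAssert 'c 'i
  | RoleAssert 'r 'i 'i

type_synonym ('c, 'r, 'i, 'v) ann_axiom = "('c, 'r, 'i) elhr_axiom \<times> 'v monomial"

definition annotated_ontology :: "('c, 'r, 'i, 'v) ann_axiom set \<Rightarrow> bool" where
  "annotated_ontology \<O> \<longleftrightarrow>
     finite \<O> \<and> (\<forall>(\<alpha>, v) \<in> \<O>. v = {#} \<or> (\<exists>x. v = {#x#}))"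

definition ontology_cnames :: "('c, 'r, 'i, 'v) ann_axiom set \<Rightarrow> 'c set" where
  "ontology_cnames \<O> = (\<Union>(\<alpha>, v) \<in> \<O>. axiom_cnames \<alpha>)"

text \<open>
  Both domains are subsets of one universe type \<open>'u\<close>.
\<close>

record ('c, 'r, 'i, 'v, 'u) interp =
  delta :: "'u set"
  delta_m :: "'u set"
  iconc :: "'c \<Rightarrow> ('u \<times> 'u) set"
  irole :: "'r \<Rightarrow> ('u \<times> 'u \<times> 'u) set"
  iind :: "'i \<Rightarrow> 'u"
  imon :: "'v monomial \<Rightarrow> 'u"

definition annotated_interp :: "('c, 'r, 'i, 'v, 'u) interp \<Rightarrow> bool" where
  "annotated_interp I \<longleftrightarrow>
     delta I \<noteq> {} \<and> delta_m I \<noteq> {} \<and> delta I \<inter> delta_m I = {} \<and>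
     (\<forall>a. iind I a \<in> delta I) \<and>
     (\<forall>A. iconc I A \<subseteq> delta I \<times> delta_m I) \<and>
     (\<forall>R. irole I R \<subseteq> delta I \<times> delta I \<times> delta_m I) \<and>
     (\<forall>m. imon I m \<in> delta_m I) \<and>
     (\<forall>m n. imon I m = imon I n \<longleftrightarrow> m \<approx> n)"

fun concept_ext :: "('c, 'r, 'i, 'v, 'u) interp \<Rightarrow> ('c, 'r) concept \<Rightarrow> ('u \<times> 'u) set" where
  "concept_ext I Top = delta I \<times> {imon I {#}}"
| "concept_ext I (Atom A) = iconc I A"
| "concept_ext I (Exists R C) =
     {(d, imon I (m + n)) | d m n.
        \<exists>e. (d, e, imon I m) \<in> irole I R \<and> (e, imon I n) \<in> concept_ext I C}"
| "concept_ext I (Conj C D) =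
     {(d, imon I (m + n)) | d m n.
        (d, imon I m) \<in> concept_ext I C \<and> (d, imon I n) \<in> concept_ext I D}"

fun rhs_ext :: "('c, 'r, 'i, 'v, 'u) interp \<Rightarrow> ('c, 'r) rhs \<Rightarrow> ('u \<times> 'u) set" where
  "rhs_ext I (RAtom A) = iconc I A"
| "rhs_ext I (RSome R) = {(d, \<mu>) | d \<mu>. \<exists>e. (d, e, \<mu>) \<in> irole I R}"

definition ran_ext :: "('c, 'r, 'i, 'v, 'u) interp \<Rightarrow> 'r \<Rightarrow> ('u \<times> 'u) set" where
  "ran_ext I R = {(e, \<mu>) | e \<mu>. \<exists>d. (d, e, \<mu>) \<in> irole I R}"

fun satisfies :: "('c, 'r, 'i, 'v, 'u) interp \<Rightarrow> ('c, 'r, 'i) elhr_axiom \<Rightarrow> 'v monomial \<Rightarrow> bool" where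
  "satisfies I (GCI C D) m \<longleftrightarrow>
     (\<forall>n d. (d, imon I n) \<in> concept_ext I C \<longrightarrow> (d, imon I (m + n)) \<in> rhs_ext I D)"
| "satisfies I (RoleIncl R S) m \<longleftrightarrow>
     (\<forall>n d e. (d, e, imon I n) \<in> irole I R \<longrightarrow> (d, e, imon I (m + n)) \<in> irole I S)"
| "satisfies I (RangeRestr R A) m \<longleftrightarrow>
     (\<forall>n d. (d, imon I n) \<in> ran_ext I R \<longrightarrow> (d, imon I (m + n)) \<in> iconc I A)"
| "satisfies I (ConceptAssert A a) m \<longleftrightarrow> (iind I a, imon I m) \<in> iconc I A"
| "satisfies I (RoleAssert R a b) m \<longleftrightarrow> (iind I a, iind I b, imon I m) \<in> irole I R"

definition is_model :: "('c, 'r, 'i, 'v, 'u) interp \<Rightarrow> ('c, 'r, 'i, 'v) ann_axiom set \<Rightarrow> bool" where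
  "is_model I \<O> \<longleftrightarrow> annotated_interp I \<and> (\<forall>(\<alpha>, m) \<in> \<O>. satisfies I \<alpha> m)"

text \<open>
  HOL cannot quantify over types inside a formula, so entailment ranges over the
  interpretations in a universe \<open>'u\<close> passed as a type argument; theorems are to be
  polymorphic in \<open>'u\<close>.
\<close>

definition entails ::
  "'u itself \<Rightarrow> ('c, 'r, 'i, 'v) ann_axiom set \<Rightarrow> ('c, 'r, 'i) elhr_axiom \<Rightarrow> 'v monomial \<Rightarrow> bool" where
  "entails U \<O> \<alpha> m \<longleftrightarrow>
     (\<forall>I :: ('c, 'r, 'i, 'v, 'u) interp. is_model I \<O> \<longrightarrow> satisfies I \<alpha> m)"

text \<open>The hatted concepts of the rules: neither a concept name nor \<open>Top\<close>.\<close>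

definition complex_concept :: "('c, 'r) concept \<Rightarrow> bool" where
  "complex_concept C \<longleftrightarrow> C \<noteq> Top \<and> (\<forall>A. C \<noteq> Atom A)"

inductive nf_step ::
  "('c, 'r, 'i, 'v) ann_axiom set \<Rightarrow> ('c, 'r, 'i, 'v) ann_axiom set \<Rightarrow> bool" where
  NF1: "\<lbrakk>(GCI (Conj C D) E, v) \<in> \<O>; complex_concept D; A \<notin> ontology_cnames \<O>\<rbrakk> \<Longrightarrow>
    nf_step \<O> (\<O> - {(GCI (Conj C D) E, v)} \<union>
               {(GCI D (RAtom A), {#}), (GCI (Conj C (Atom A)) E, v)})"
| NF2: "\<lbrakk>(GCI (Exists R C) D, v) \<in> \<O>; complex_concept C; A \<notin> ontology_cnames \<O>\<rbrakk> \<Longrightarrow>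
    nf_step \<O> (\<O> - {(GCI (Exists R C) D, v)} \<union>
               {(GCI C (RAtom A), {#}), (GCI (Exists R (Atom A)) D, v)})"
| NF3: "\<lbrakk>(GCI C (RSome R), v) \<in> \<O>; complex_concept C; A \<notin> ontology_cnames \<O>\<rbrakk> \<Longrightarrow>
    nf_step \<O> (\<O> - {(GCI C (RSome R), v)} \<union>
               {(GCI C (RAtom A), {#}), (GCI (Atom A) (RSome R), v)})"

text \<open>Exhaustive application: finitely many rule applications until no rule applies.\<close>

definition normalisation ::
  "('c, 'r, 'i, 'v) ann_axiom set \<Rightarrow> ('c, 'r, 'i, 'v) ann_axiom set \<Rightarrow> bool" where
  "normalisation \<O> \<O>' \<longleftrightarrow> nf_step\<^sup>*\<^sup>* \<O> \<O>' \<and> (\<nexists>\<O>''. nf_step \<O>' \<O>'')"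

end

theory Submission
  imports Defs
begin

text \<open>
  Every model of the normalised ontology is a model of the original one, because the fresh name
  contains the concept it abbreviates and concept constructors are monotone. Conversely, a model of
  the original ontology becomes a model of the normalised one when the fresh name is interpreted as
  the extension of the concept it abbreviates, which leaves all axioms over the old names unaffected.
\<close>

lemma concept_ext_iconc_upd:
  "A \<notin> concept_cnames C \<Longrightarrow>
     concept_ext (I\<lparr>iconc := (iconc I)(A := S)\<rparr>) C = concept_ext I C"
  by (induction C) auto

lemma rhs_ext_iconc_upd:
  "A \<notin> rhs_cnames D \<Longrightarrow> rhs_ext (I\<lparr>iconc := (iconc I)(A := S)\<rparr>) D = rhs_ext I D"
  by (cases D) auto

lemma satisfies_iconc_upd:
  "A \<notin> axiom_cnames \<alpha> \<Longrightarrow>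
     satisfies (I\<lparr>iconc := (iconc I)(A := S)\<rparr>) \<alpha> m \<longleftrightarrow> satisfies I \<alpha> m"
  by (cases \<alpha>) (auto simp: concept_ext_iconc_upd rhs_ext_iconc_upd ran_ext_def)

text \<open>Makes the extension of a concept an admissible value for a concept name. For
  \<open>Exists\<close> and \<open>Conj\<close> the second component is some
  \<open>imon I (m + n)\<close>, which lies in \<open>delta_m I\<close>.\<close>

lemma concept_ext_subset:
  assumes "annotated_interp I"
  shows "concept_ext I C \<subseteq> delta I \<times> delta_m I"
  using assms by (induction C) (fastforce simp: annotated_interp_def)+

text \<open>
  Common form of the three rules: \<open>C'\<close> arises from \<open>C\<close> by replacing the occurrence of
  \<open>D\<close> with the fresh name \<open>A\<close>.
\<close>

lemma nf_stepE:
  fixes \<O> \<O>' :: "('c, 'r, 'i, 'v) ann_axiom set"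
  assumes "nf_step \<O> \<O>'"
  obtains C D C' E v A where
    "(GCI C E, v) \<in> \<O>" "A \<notin> ontology_cnames \<O>"
    "\<O>' = \<O> - {(GCI C E, v)} \<union> {(GCI D (RAtom A), {#}), (GCI C' E, v)}"
    "concept_cnames D \<subseteq> concept_cnames C"
    "concept_cnames C \<subseteq> concept_cnames C' \<union> concept_cnames D"
    "\<And>I :: ('c, 'r, 'i, 'v, 'u) interp.
       iconc I A = concept_ext I D \<Longrightarrow> concept_ext I C' = concept_ext I C"
    "\<And>(I :: ('c, 'r, 'i, 'v, 'u) interp) d n.
       \<lbrakk>\<And>d n. (d, imon I n) \<in> concept_ext I D \<Longrightarrow> (d, imon I n) \<in> iconc I A;
        (d, imon I n) \<in> concept_ext I C\<rbrakk> \<Longrightarrow> (d, imon I n) \<in> concept_ext I C'"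
  using assms
proof cases
  case (NF1 C D E v A)
  \<comment> \<open>Unification with the equation for \<open>\<O>'\<close> reads off the replaced
    subconcept and \<open>C'\<close>; what remains concerns the single constructor
    \<open>Conj\<close>.\<close>
  show thesis
    by (rule that[OF NF1(2,4,1)]) (simp_all, blast+)
next
  case (NF2 R C D v A)
  show thesis
    by (rule that[OF NF2(2,4,1)]) (simp_all, blast+)
next
  case (NF3 C R v A)
  \<comment> \<open>Here the replaced occurrence is the whole left-hand side, so \<open>C'\<close>
    is \<open>Atom A\<close> itself.\<close>
  show thesis
    by (rule that[OF NF3(2,4,1)]) auto
qed

lemma nf_step_model:
  fixes I :: "('c, 'r, 'i, 'v, 'u) interp"
  assumes "nf_step \<O> \<O>'" and "is_model I \<O>'"
  shows "is_model I \<O>"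
  using assms(1)
proof (rule nf_stepE[where 'u = 'u])
  fix C D C' E v A
  assume \<O>': "\<O>' = \<O> - {(GCI C E, v)} \<union> {(GCI D (RAtom A), {#}), (GCI C' E, v)}"
    and mono: "\<And>(I :: ('c, 'r, 'i, 'v, 'u) interp) d n.
       \<lbrakk>\<And>d n. (d, imon I n) \<in> concept_ext I D \<Longrightarrow> (d, imon I n) \<in> iconc I A;
        (d, imon I n) \<in> concept_ext I C\<rbrakk> \<Longrightarrow> (d, imon I n) \<in> concept_ext I C'"
  have D: "satisfies I (GCI D (RAtom A)) {#}" and C': "satisfies I (GCI C' E) v"
    using assms(2) unfolding is_model_def \<O>' by auto
  \<comment> \<open>The fact \<open>D\<close> yields the premise of \<open>mono\<close>, since its
    annotation \<open>{#}\<close> adds no factor. Satisfaction of a GCI speaks only of pairs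
    \<open>(d, imon I n)\<close>, hence the restricted form of \<open>mono\<close>.\<close>
  have "satisfies I (GCI C E) v"
    using C' mono[of I] D by simp
  then show "is_model I \<O>"
    using assms(2) unfolding is_model_def \<O>' by auto
qed

lemma nf_step_model_extension:
  fixes I :: "('c, 'r, 'i, 'v, 'u) interp"
  assumes "nf_step \<O> \<O>'" and "is_model I \<O>"
  obtains J :: "('c, 'r, 'i, 'v, 'u) interp" where "is_model J \<O>'"
    and "\<And>\<alpha> m. axiom_cnames \<alpha> \<subseteq> ontology_cnames \<O> \<Longrightarrow> satisfies J \<alpha> m \<longleftrightarrow> satisfies I \<alpha> m"
  using assms(1)
proof (rule nf_stepE[where 'u = 'u])
  fix C D C' E v A
  assume CE: "(GCI C E, v) \<in> \<O>" and A: "A \<notin> ontology_cnames \<O>"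
    and \<O>': "\<O>' = \<O> - {(GCI C E, v)} \<union> {(GCI D (RAtom A), {#}), (GCI C' E, v)}"
    and D: "concept_cnames D \<subseteq> concept_cnames C"
    and eq: "\<And>I :: ('c, 'r, 'i, 'v, 'u) interp.
       iconc I A = concept_ext I D \<Longrightarrow> concept_ext I C' = concept_ext I C"
  define J where "J = I\<lparr>iconc := (iconc I)(A := concept_ext I D)\<rparr>"
  have sat: "satisfies J \<alpha> m \<longleftrightarrow> satisfies I \<alpha> m" if "axiom_cnames \<alpha> \<subseteq> ontology_cnames \<O>" for \<alpha> m
    unfolding J_def using that A by (intro satisfies_iconc_upd) blast
  have old: "satisfies J \<alpha> m" if "(\<alpha>, m) \<in> \<O>" for \<alpha> m
  proof -
    have "axiom_cnames \<alpha> \<subseteq> ontology_cnames \<O>"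
      using that by (auto simp: ontology_cnames_def)
    with that sat assms(2) show ?thesis
      by (auto simp: is_model_def)
  qed
  \<comment> \<open>Freshness keeps the choice of \<open>J\<close> from being circular:
    \<open>D\<close> does not mention \<open>A\<close>, so reinterpreting \<open>A\<close> leaves
    its extension unchanged.\<close>
  have "A \<notin> concept_cnames D"
    using A CE D by (force simp: ontology_cnames_def)
  then have ext: "iconc J A = concept_ext J D"
    by (simp add: J_def concept_ext_iconc_upd)
  have "satisfies J (GCI C' E) v"
    using old[OF CE] eq[OF ext] by simp
  moreover have "satisfies J (GCI D (RAtom A)) {#}"
    using ext by simp
  moreover have "annotated_interp J"
    using assms(2) concept_ext_subset[of I D]
    unfolding is_model_def annotated_interp_def J_def by simp
  ultimately have "is_model J \<O>'"
    using old unfolding is_model_def \<O>' by auto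
  then show thesis
    using that sat by blast
qed

text \<open>The names of the removed axiom survive in the two new ones. This passes a name condition
  on the initial ontology along a sequence of steps.\<close>

lemma nf_step_cnames:
  assumes "nf_step \<O> \<O>'"
  shows "ontology_cnames \<O> \<subseteq> ontology_cnames \<O>'"
  using assms
  by (rule nf_stepE) (fastforce simp: ontology_cnames_def)

lemma nf_step_entails:
  assumes "nf_step \<O> \<O>'" and "entails TYPE('u) \<O> \<alpha> m"
  shows "entails TYPE('u) \<O>' \<alpha> m"
  using assms nf_step_model unfolding entails_def by blast

text \<open>Any model of \<open>\<O>\<close> yields a model of \<open>\<O>'\<close>, which satisfies
  \<open>\<alpha>\<close>; satisfaction transfers back because \<open>\<alpha>\<close> avoids the
  fresh name.\<close>

lemma nf_step_conservative:
  assumes "nf_step \<O> \<O>'" and "entails TYPE('u) \<O>' \<alpha> m"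
    and "axiom_cnames \<alpha> \<subseteq> ontology_cnames \<O>"
  shows "entails TYPE('u) \<O> \<alpha> m"
  using assms nf_step_model_extension[OF assms(1)] unfolding entails_def by metis

lemma nf_steps_conservative:
  assumes "nf_step\<^sup>*\<^sup>* \<O> \<O>'"
  shows "(entails TYPE('u) \<O> \<alpha> m \<longrightarrow> entails TYPE('u) \<O>' \<alpha> m) \<and>
         (entails TYPE('u) \<O>' \<alpha> m \<and> axiom_cnames \<alpha> \<subseteq> ontology_cnames \<O>
            \<longrightarrow> entails TYPE('u) \<O> \<alpha> m)"
  using assms
proof (induction rule: converse_rtranclp_induct)
  case (step \<O>1 \<O>2)
  then show ?case
    using nf_step_entails nf_step_conservative nf_step_cnames by (metis subset_trans)
qed simp

theorem theorem1:
  fixes \<O> \<O>' :: "('c::{countable,infinite}, 'r::{countable,infinite},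
                     'i::{countable,infinite}, 'v::{countable,infinite}) ann_axiom set"
    and \<alpha> :: "('c, 'r, 'i) elhr_axiom"
    and m :: "'v monomial"
  assumes "annotated_ontology \<O>"
    and "normalisation \<O> \<O>'"
  shows "(entails TYPE('u) \<O> \<alpha> m \<longrightarrow> entails TYPE('u) \<O>' \<alpha> m) \<and>
         (entails TYPE('u) \<O>' \<alpha> m \<and> axiom_cnames \<alpha> \<subseteq> ontology_cnames \<O>
            \<longrightarrow> entails TYPE('u) \<O> \<alpha> m)"
  using assms(2) nf_steps_conservative unfolding normalisation_def by blast

end
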